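(* Let $(X,d)$ be a nonempty metric space and let $T: X \to X$ be a map. Suppose that $X$ is $T$-orbitally complete and that $T$ is a generalized quasi-contraction with constant $q \in [0,1)$, i.e. for all $x,y\in X$, $$d(Tx,Ty) \le q \max\big\{d(x,y),\, d(x,Tx),\, d(y,Ty),\, d(x,Ty),\, d(y,Tx),\, d(T^2x,x),\, d(T^2x,Tx),\, d(T^2x,y),\, d(T^2x,Ty)\big\}.$$ Then: (1) $T$ has a unique fixed point $x^*$ in $X$. (2) $\lim_{n\to\infty} T^n x = x^*$ for all $x \in X$. (3) $d(T^n x, x^* ) \le \dfrac{q^n}{1-q}\, d(x,Tx)$ for all $x \in X$ and all $n \in \mathbb{N}$.
   Context: For a map $T: X\to X$ on a metric space and $x\in X$, the orbit of $T$ at $x$ is $O_T(x,+\infty)=\{x,Tx,\ldots,T^nx,\ldots\}$, where $T^n$ is the $n$-fold iterate of $T$. The space $X$ is called $T$-orbitally complete if, for every $x \in X$, every Cauchy sequence in $O_T(x,+\infty)$ converges in $X$. A map $T:X\to X$ is called a generalized quasi-contraction if there exists $q\in[0,1)$ such that the inequality displayed in the claim holds for all $x,y\in X$. $\mathbb{N}$ denotes the positive integers. *)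

theory Defs
  imports "HOL-Analysis.Analysis"
begin

definition orbit_from :: "('a \<Rightarrow> 'a) \<Rightarrow> 'a \<Rightarrow> 'a set" where
  "orbit_from T x = range (\<lambda>n. (T ^^ n) x)"

context Metric_space
begin

definition orbitally_complete :: "('a \<Rightarrow> 'a) \<Rightarrow> bool" where
  "orbitally_complete T \<longleftrightarrow>
     (\<forall>x\<in>M. \<forall>\<sigma>. range \<sigma> \<subseteq> orbit_from T x \<and> MCauchy \<sigma> \<longrightarrow>
        (\<exists>l. limitin mtopology \<sigma> l sequentially))"

(* The constant is an argument, rather than existentially quantified, because the
   error estimate of the fixed point theorem refers to it. *)
definition generalized_quasi_contraction :: "('a \<Rightarrow> 'a) \<Rightarrow> real \<Rightarrow> bool" where
  "generalized_quasi_contraction T q \<longleftrightarrow>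
     0 \<le> q \<and> q < 1 \<and>
     (\<forall>x\<in>M. \<forall>y\<in>M.
        d (T x) (T y) \<le>
          q * Max {d x y, d x (T x), d y (T y), d x (T y), d y (T x),
                   d ((T ^^ 2) x) x, d ((T ^^ 2) x) (T x),
                   d ((T ^^ 2) x) y, d ((T ^^ 2) x) (T y)})"

end

end

theory Submission
  imports Defs
begin

text \<open>
  Writing \<open>x\<^sub>n\<close> for \<open>T\<^sup>n x\<close>, if the points \<open>x\<^sub>n, \<dots>, x\<^sub>N\<close> are within distance \<open>K\<close> of each
  other, then \<open>x\<^sub>n\<^sub>+\<^sub>1, \<dots>, x\<^sub>N\<close> are within distance \<open>q K\<close>. For \<open>n = 0\<close> this forces
  the diameter of a finite orbit segment to satisfy \<open>K \<le> d(x, Tx) + q K\<close>; iterating it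
  yields \<open>d(x\<^sub>m, x\<^sub>n) \<le> q\<^sup>n / (1 - q) d(x, Tx)\<close> for \<open>m \<ge> n\<close>. The limit is fixed because
  the contraction inequality at \<open>(x\<^sub>n, u)\<close> becomes \<open>d(u, Tu) \<le> q d(u, Tu)\<close>.
\<close>

context Metric_space
begin

text \<open>Trades the maximum for any common upper bound \<open>K\<close>, so that each application
  splits into separate estimates of the nine distances.\<close>

lemma generalized_quasi_contractionD:
  assumes "generalized_quasi_contraction T q" "x \<in> M" "y \<in> M"
    and "d x y \<le> K" "d x (T x) \<le> K" "d y (T y) \<le> K" "d x (T y) \<le> K" "d y (T x) \<le> K"
    and "d ((T ^^ 2) x) x \<le> K" "d ((T ^^ 2) x) (T x) \<le> K"
    and "d ((T ^^ 2) x) y \<le> K" "d ((T ^^ 2) x) (T y) \<le> K"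
  shows "d (T x) (T y) \<le> q * K"
proof -
  let ?S = "{d x y, d x (T x), d y (T y), d x (T y), d y (T x),
             d ((T ^^ 2) x) x, d ((T ^^ 2) x) (T x), d ((T ^^ 2) x) y, d ((T ^^ 2) x) (T y)}"
  have "d (T x) (T y) \<le> q * Max ?S" and "0 \<le> q"
    using assms(1-3) unfolding generalized_quasi_contraction_def by blast+
  moreover have "Max ?S \<le> K"
    using assms(4-) by (subst Max_le_iff) simp_all
  ultimately show ?thesis
    by (meson mult_left_mono order_trans)
qed

lemma funpow_in_M: "T \<in> M \<rightarrow> M \<Longrightarrow> x \<in> M \<Longrightarrow> (T ^^ n) x \<in> M"
  by (induction n) auto

text \<open>At the iterates with indices i < j < \<open>N\<close>, the nine distances involve only
  the indices i, i+1, i+2, j, j+1, and i+2 \<le> j+1 \<le> \<open>N\<close> keeps them all inside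
  the segment.\<close>

lemma orbit_segment_contraction:
  assumes T: "T \<in> M \<rightarrow> M" and gqc: "generalized_quasi_contraction T q" and x: "x \<in> M"
    and K: "\<And>a b. \<lbrakk>n \<le> a; a \<le> N; n \<le> b; b \<le> N\<rbrakk> \<Longrightarrow> d ((T ^^ a) x) ((T ^^ b) x) \<le> K"
    and ab: "Suc n \<le> a" "a \<le> N" "Suc n \<le> b" "b \<le> N"
  shows "d ((T ^^ a) x) ((T ^^ b) x) \<le> q * K"
proof -
  \<comment> \<open>The term \<open>T\<^sup>2 x\<close> stays inside the segment only if the inequality is applied with the
      smaller index first.\<close>
  have less: "d ((T ^^ a) x) ((T ^^ b) x) \<le> q * K" if "Suc n \<le> a" "a < b" "b \<le> N" for a b
  proof -
    from that obtain i where i: "a = Suc i" "n \<le> i" by (cases a) auto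
    from that obtain j where j: "b = Suc j" "i < j" using i by (cases b) auto
    have "d (T ((T ^^ i) x)) (T ((T ^^ j) x)) \<le> q * K"
    proof (rule generalized_quasi_contractionD[OF gqc])
      have eqs: "T ((T ^^ m) x) = (T ^^ Suc m) x"
        "(T ^^ 2) ((T ^^ m) x) = (T ^^ Suc (Suc m)) x" for m
        by (simp_all add: numeral_2_eq_2)
      show "d ((T ^^ i) x) ((T ^^ j) x) \<le> K"
        "d ((T ^^ i) x) (T ((T ^^ i) x)) \<le> K" "d ((T ^^ j) x) (T ((T ^^ j) x)) \<le> K"
        "d ((T ^^ i) x) (T ((T ^^ j) x)) \<le> K" "d ((T ^^ j) x) (T ((T ^^ i) x)) \<le> K"
        "d ((T ^^ 2) ((T ^^ i) x)) ((T ^^ i) x) \<le> K"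
        "d ((T ^^ 2) ((T ^^ i) x)) (T ((T ^^ i) x)) \<le> K"
        "d ((T ^^ 2) ((T ^^ i) x)) ((T ^^ j) x) \<le> K"
        "d ((T ^^ 2) ((T ^^ i) x)) (T ((T ^^ j) x)) \<le> K"
        unfolding eqs using i j that by (auto intro!: K simp del: funpow.simps)
    qed (use T x in \<open>auto intro: funpow_in_M\<close>)
    then show ?thesis by (simp add: i j)
  qed
  \<comment> \<open>Settles the case \<open>a = b\<close>, on which \<open>less\<close> is silent:
    the distance there is 0.\<close>
  have "0 \<le> q * K"
  proof (rule mult_nonneg_nonneg)
    show "0 \<le> q" using gqc unfolding generalized_quasi_contraction_def by blast
    show "0 \<le> K" using K[of a a] ab nonneg[of "(T ^^ a) x" "(T ^^ a) x"] by linarith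
  qed
  then show ?thesis
    using less[of a b] less[of b a] ab x T
    by (cases a b rule: linorder_cases) (auto simp: commute funpow_in_M)
qed

text \<open>Being a maximum over finitely many pairs, \<open>K\<close> is a real number, so
  \<open>K \<le> d x (T x) + q * K\<close> can be solved for \<open>K\<close>. The resulting bound
  does not depend on \<open>N\<close>.\<close>

lemma orbit_dist_le:
  assumes T: "T \<in> M \<rightarrow> M" and gqc: "generalized_quasi_contraction T q" and x: "x \<in> M"
  shows "d ((T ^^ a) x) ((T ^^ b) x) \<le> d x (T x) / (1 - q)"
proof -
  define N where "N = max a b"
  define K where "K = Max ((\<lambda>(i, j). d ((T ^^ i) x) ((T ^^ j) x)) ` ({..N} \<times> {..N}))"
  have q: "0 \<le> q" "q < 1"
    using gqc unfolding generalized_quasi_contraction_def by blast+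
  have K: "d ((T ^^ i) x) ((T ^^ j) x) \<le> K" if "i \<le> N" "j \<le> N" for i j
    unfolding K_def by (rule Max_ge) (use that in auto)
  have qK: "d ((T ^^ i) x) ((T ^^ j) x) \<le> q * K" if "1 \<le> i" "i \<le> N" "1 \<le> j" "j \<le> N" for i j
    using orbit_segment_contraction[OF T gqc x, of 0 N K i j] K that by simp
  have "0 \<le> K" using K[of 0 0] nonneg order_trans by blast
  then have qK0: "0 \<le> q * K" using q by simp
  \<comment> \<open>Only pairs containing the index 0 escape \<open>qK\<close>; a detour through
    \<open>T x\<close> costs one extra \<open>d x (T x)\<close>.\<close>
  have first: "d x ((T ^^ j) x) \<le> d x (T x) + q * K" if "j \<le> N" for j
  proof (cases "j = 0")
    case True
    then show ?thesis using x qK0 nonneg[of x "T x"] by simp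
  next
    case False
    then have "d (T x) ((T ^^ j) x) \<le> q * K" using qK[of 1 j] that by simp
    moreover have "d x ((T ^^ j) x) \<le> d x (T x) + d (T x) ((T ^^ j) x)"
      using T x by (intro triangle) (auto intro: funpow_in_M)
    ultimately show ?thesis by simp
  qed
  have "d ((T ^^ i) x) ((T ^^ j) x) \<le> d x (T x) + q * K" if "i \<le> N" "j \<le> N" for i j
  proof (cases "i = 0 \<or> j = 0")
    case True
    then show ?thesis using first that commute by auto
  next
    case False
    then have "d ((T ^^ i) x) ((T ^^ j) x) \<le> q * K" using qK[of i j] that by simp
    then show ?thesis using nonneg[of x "T x"] by linarith
  qed
  then have "K \<le> d x (T x) + q * K"
    unfolding K_def by (subst Max_le_iff) auto
  then have "K \<le> d x (T x) / (1 - q)"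
    using q by (simp add: field_simps)
  moreover have "d ((T ^^ a) x) ((T ^^ b) x) \<le> K"
    by (rule K) (auto simp: N_def)
  ultimately show ?thesis by simp
qed

text \<open>Each induction step drops the leftmost index of the segment and gains a factor
  \<open>q\<close>. The hypothesis is needed for all pairs up to \<open>max a b\<close>, hence the
  generalization over \<open>a\<close> and \<open>b\<close>.\<close>

lemma orbit_tail_dist_le:
  assumes T: "T \<in> M \<rightarrow> M" and gqc: "generalized_quasi_contraction T q" and x: "x \<in> M"
    and "n \<le> a" "n \<le> b"
  shows "d ((T ^^ a) x) ((T ^^ b) x) \<le> q ^ n / (1 - q) * d x (T x)"
  using \<open>n \<le> a\<close> \<open>n \<le> b\<close>
proof (induction n arbitrary: a b)
  case 0
  then show ?case using orbit_dist_le[OF T gqc x] by simp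
next
  case (Suc n)
  then have "d ((T ^^ a) x) ((T ^^ b) x) \<le> q * (q ^ n / (1 - q) * d x (T x))"
    by (intro orbit_segment_contraction[OF T gqc x, of n "max a b"]) auto
  then show ?case by simp
qed

lemma MCauchy_orbit:
  assumes T: "T \<in> M \<rightarrow> M" and gqc: "generalized_quasi_contraction T q" and x: "x \<in> M"
  shows "MCauchy (\<lambda>n. (T ^^ n) x)"
  unfolding MCauchy_def
proof (intro conjI allI impI)
  show "range (\<lambda>n. (T ^^ n) x) \<subseteq> M"
    using T x by (auto intro: funpow_in_M)
next
  fix \<epsilon> :: real
  assume "\<epsilon> > 0"
  have "0 \<le> q" "q < 1"
    using gqc unfolding generalized_quasi_contraction_def by blast+
  then have "(\<lambda>n. q ^ n / (1 - q) * d x (T x)) \<longlonglongrightarrow> 0 / (1 - q) * d x (T x)"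
    by (intro tendsto_intros LIMSEQ_power_zero) auto
  then have "\<forall>\<^sub>F n in sequentially. q ^ n / (1 - q) * d x (T x) < \<epsilon>"
    using \<open>\<epsilon> > 0\<close> by (intro order_tendstoD(2)) auto
  then obtain N where "q ^ N / (1 - q) * d x (T x) < \<epsilon>"
    by (auto simp: eventually_sequentially)
  then show "\<exists>N. \<forall>n n'. N \<le> n \<longrightarrow> N \<le> n' \<longrightarrow> d ((T ^^ n) x) ((T ^^ n') x) < \<epsilon>"
    using orbit_tail_dist_le[OF T gqc x] by (meson le_less_trans)
qed

text \<open>Far along the orbit, \<open>y\<close>, \<open>T y\<close> and \<open>z\<close> are all
  close to \<open>u\<close>, so up to a small error the nine distances at \<open>(y, u)\<close> are
  at most \<open>d u (T u)\<close>.\<close>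

lemma orbit_limit_is_fixed_point:
  assumes T: "T \<in> M \<rightarrow> M" and gqc: "generalized_quasi_contraction T q" and x: "x \<in> M"
    and lim: "limitin mtopology (\<lambda>n. (T ^^ n) x) u sequentially"
  shows "T u = u"
proof (rule ccontr)
  assume "T u \<noteq> u"
  have u: "u \<in> M" using lim by (simp add: limitin_metric)
  have Tu: "T u \<in> M" using T u by auto
  have q: "0 \<le> q" "q < 1"
    using gqc unfolding generalized_quasi_contraction_def by blast+
  define D where "D = d u (T u)"
  have "D > 0" using u Tu \<open>T u \<noteq> u\<close> unfolding D_def by (metis mdist_pos_eq)
  \<comment> \<open>The errors below add up to at most \<open>3 * e\<close>, giving
    \<open>D - q * D \<le> 3 * e\<close>, whereas this choice makes \<open>D - q * D\<close> equal
    to \<open>4 * e\<close>.\<close>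
  define e where "e = (1 - q) * D / 4"
  have e: "e > 0" using q \<open>D > 0\<close> by (simp add: e_def)
  obtain N where N: "\<And>n. N \<le> n \<Longrightarrow> d ((T ^^ n) x) u < e"
    using lim e unfolding limitin_metric eventually_sequentially by metis
  define y where "y = (T ^^ N) x"
  define z where "z = (T ^^ 2) y"
  have y: "y \<in> M" "T y \<in> M" and z: "z \<in> M"
    using T x by (auto simp: y_def z_def numeral_2_eq_2 intro: funpow_in_M)
  have near: "d y u < e" "d (T y) u < e" "d z u < e"
    using N[of N] N[of "Suc N"] N[of "Suc (Suc N)"] by (auto simp: y_def z_def numeral_2_eq_2)
  have to_u: "d u v < e" if "d v u < e" for v
    using that by (simp add: commute)
  \<comment> \<open>The summand \<open>D\<close> is slack, added so that \<open>mutual\<close> and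
    \<open>to_Tu\<close> provide one common bound.\<close>
  have mutual: "d v w \<le> 2 * e + D" if "v \<in> M" "w \<in> M" "d v u < e" "d w u < e" for v w
    using triangle[of v u w] that u to_u[of w] \<open>D > 0\<close> by simp
  have to_Tu: "d v (T u) \<le> 2 * e + D" if "v \<in> M" "d v u < e" for v
    using triangle[of v u "T u"] that u Tu e by (simp add: D_def)
  have Duu: "d u u < e" "0 < D" using u e \<open>D > 0\<close> by auto
  have "d (T y) (T u) \<le> q * (2 * e + D)"
    by (rule generalized_quasi_contractionD[OF gqc y(1) u], unfold z_def[symmetric])
       (insert near y z u e Duu, auto intro!: mutual to_Tu simp: D_def[symmetric])
  moreover have "D \<le> d u (T y) + d (T y) (T u)"
    unfolding D_def using u Tu y by (intro triangle) auto
  moreover have "q * e \<le> e" using q e by (simp add: mult_left_le_one_le)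
  ultimately have "D \<le> 3 * e + q * D"
    using to_u[OF near(2)] by (simp add: algebra_simps)
  moreover have "4 * e = D - q * D"
    by (simp add: e_def left_diff_distrib)
  ultimately show False using e by linarith
qed

text \<open>At two fixed points each of the nine distances is 0 or \<open>d u v\<close>.\<close>

lemma fixed_points_equal:
  assumes gqc: "generalized_quasi_contraction T q" and u: "u \<in> M" "T u = u" and v: "v \<in> M" "T v = v"
  shows "u = v"
proof -
  have "d (T u) (T v) \<le> q * d u v"
    by (rule generalized_quasi_contractionD[OF gqc])
       (use u v in \<open>auto simp: numeral_2_eq_2 commute\<close>)
  then have "(1 - q) * d u v \<le> 0"
    using u v by (simp add: algebra_simps)
  moreover have "q < 1"
    using gqc unfolding generalized_quasi_contraction_def by blast
  ultimately have "d u v \<le> 0"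
    by (simp add: mult_le_0_iff)
  then show ?thesis
    using u v by (metis mdist_pos_less not_less)
qed

lemma orbit_converges_to_fixed_point:
  assumes T: "T \<in> M \<rightarrow> M" and gqc: "generalized_quasi_contraction T q"
    and compl: "orbitally_complete T" and x: "x \<in> M"
  obtains u where "u \<in> M" "T u = u" "limitin mtopology (\<lambda>n. (T ^^ n) x) u sequentially"
proof -
  obtain u where u: "limitin mtopology (\<lambda>n. (T ^^ n) x) u sequentially"
    using compl x MCauchy_orbit[OF T gqc x] unfolding orbitally_complete_def orbit_from_def by blast
  moreover have "u \<in> M" using u by (simp add: limitin_metric)
  ultimately show ?thesis
    using that orbit_limit_is_fixed_point[OF T gqc x] by blast
qed

text \<open>Lets the second index tend to infinity in \<open>orbit_tail_dist_le\<close> while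
  \<open>n\<close> stays fixed.\<close>

lemma orbit_limit_dist_le:
  assumes T: "T \<in> M \<rightarrow> M" and gqc: "generalized_quasi_contraction T q" and x: "x \<in> M"
    and lim: "limitin mtopology (\<lambda>n. (T ^^ n) x) u sequentially"
  shows "d ((T ^^ n) x) u \<le> q ^ n / (1 - q) * d x (T x)"
proof (rule field_le_epsilon)
  fix e :: real
  assume "e > 0"
  with lim obtain N where u: "u \<in> M" and N: "\<And>m. N \<le> m \<Longrightarrow> d ((T ^^ m) x) u < e"
    unfolding limitin_metric eventually_sequentially by metis
  define m where "m = max n N"
  have "d ((T ^^ n) x) u \<le> d ((T ^^ n) x) ((T ^^ m) x) + d ((T ^^ m) x) u"
    using T x u by (intro triangle) (auto intro: funpow_in_M)
  moreover have "d ((T ^^ n) x) ((T ^^ m) x) \<le> q ^ n / (1 - q) * d x (T x)"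
    by (rule orbit_tail_dist_le[OF T gqc x]) (auto simp: m_def)
  moreover have "d ((T ^^ m) x) u < e"
    by (rule N) (simp add: m_def)
  ultimately show "d ((T ^^ n) x) u \<le> q ^ n / (1 - q) * d x (T x) + e"
    by simp
qed

end

theorem theorem3p1:
  fixes X :: "'a set" and d :: "'a \<Rightarrow> 'a \<Rightarrow> real" and T :: "'a \<Rightarrow> 'a" and q :: real
  assumes "Metric_space X d"
    and "X \<noteq> {}"
    and "T \<in> X \<rightarrow> X"
    and "Metric_space.orbitally_complete X d T"
    and "Metric_space.generalized_quasi_contraction X d T q"
  shows "\<exists>xs\<in>X.
           (T xs = xs \<and> (\<forall>y\<in>X. T y = y \<longrightarrow> y = xs)) \<and>
           (\<forall>x\<in>X. limitin (Metric_space.mtopology X d) (\<lambda>n. (T ^^ n) x) xs sequentially) \<and>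
           (\<forall>x\<in>X. \<forall>n\<ge>1. d ((T ^^ n) x) xs \<le> q ^ n / (1 - q) * d x (T x))"
proof -
  interpret Metric_space X d by fact
  note T = assms(3) and compl = assms(4) and gqc = assms(5)
  from \<open>X \<noteq> {}\<close> obtain x0 where "x0 \<in> X" by blast
  then obtain u where u: "u \<in> X" "T u = u"
    using orbit_converges_to_fixed_point[OF T gqc compl] by metis
  have uniq: "y = u" if "y \<in> X" "T y = y" for y
    using fixed_points_equal[OF gqc] that u by blast
  \<comment> \<open>Every orbit converges to some fixed point, which \<open>uniq\<close> identifies
    with \<open>u\<close>.\<close>
  have lim: "limitin mtopology (\<lambda>n. (T ^^ n) x) u sequentially" if "x \<in> X" for x
    using orbit_converges_to_fixed_point[OF T gqc compl that] uniq by metis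
  show ?thesis
    using u uniq lim orbit_limit_dist_le[OF T gqc _ lim] by blast
qed

end
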